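(* Let $G$ be a connected graph with vertex set $V(G)=\{1,\dots,n\}$, let $L=L(G)$, and let $\lambda_1,\dots,\lambda_n$ be the eigenvalues of $L$ with corresponding eigenvectors $c_k=(c_{1k},\dots,c_{nk})^T$, $k=1,\dots,n$, chosen real, normalized and mutually orthogonal. Then the following are equivalent. (i) $G$ is resistance regular. (ii) $L_{ii}^+=\frac{Kf(G)}{n^2}$ for all $i\in V(G)$. (iii) $r_{ij}+2L_{ij}^+$ is constant for all $i,j\in V(G)$ (i.e. it has the same value for all pairs $(i,j)$). (iv) $R(G)=2(L_{11}^+\mathbb{J}-L^+)$. (v) $\|B_i\|_{l_1}$ is constant for all $i\in V(G)$, where $B_i$ is the bottleneck matrix of $G$ at vertex $i$ and $\|M\|_{l_1}$ denotes the sum of all entries of $M$. (vi) $\sum_{k:\lambda_k\neq 0}\frac{c_{ik}^2}{\lambda_k}$ is constant for all $i\in V(G)$. (vii) All principal minors of $L+\frac{1}{n}\mathbb{J}$ of order $n-1$ are equal to $t\left(1+\frac{Kf(G)}{n}\right)$, where $t$ is the number of spanning trees in $G$. (viii) $\sum_{j\in N(i)}L_{ij}^+=\frac{d_i\,Kf(G)}{n^2}+\frac1n-1$ for all $i\in V(G)$.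
   Context: All graphs are finite, simple, undirected and connected. $N(i)$ is the set of vertices adjacent to $i$ and $d_i=|N(i)|$. $L(G)=D-A$ is the Laplacian matrix ($D$ the diagonal degree matrix, $A$ the adjacency matrix), $L^+=L^+(G)$ is its Moore-Penrose inverse with entries $L^+_{ij}$. $\mathbb{J}$ is the $n\times n$ all-ones matrix. The resistance distance $r_{ij}$ is the effective resistance between vertices $i$ and $j$ when each edge of $G$ carries a unit resistance; equivalently (known fact) $r_{ij}=L_{ii}^++L_{jj}^+-2L_{ij}^+$. The resistance matrix is $R(G)=(r_{ij})$. $G$ is resistance regular if all row sums of $R(G)$ are equal. The Kirchhoff index is $Kf(G)=\frac12\sum_{i,j\in V(G)}r_{ij}$. The bottleneck matrix of $G$ at a vertex $v$ is $(L(v))^{-1}$, where $L(v)$ is the principal submatrix of $L$ obtained by removing the row and column corresponding to $v$ (it is invertible). *)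

theory Defs
  imports "Jordan_Normal_Form.Char_Poly" "Jordan_Normal_Form.Gauss_Jordan_Elimination"
begin

text \<open>
  A graph is given by its order \<open>n\<close> and its set \<open>E\<close> of undirected edges, which are two-element
  sets of vertices.  The vertex set is \<open>{..<n}\<close>, so that vertices are the 0-based row and column
  indices of \<^typ>\<open>real mat\<close>: the vertices usually called \<open>1, \<dots>, n\<close> are \<open>0, \<dots>, n - 1\<close> here.
\<close>

definition simple_graph :: "nat \<Rightarrow> nat set set \<Rightarrow> bool" where
  "simple_graph n E \<longleftrightarrow> (\<forall>e\<in>E. e \<subseteq> {..<n} \<and> card e = 2)"

definition connected_graph :: "nat \<Rightarrow> nat set set \<Rightarrow> bool" where
  "connected_graph n E \<longleftrightarrow> 0 < n \<and> (\<forall>u<n. \<forall>v<n. (u, v) \<in> {(x, y). {x, y} \<in> E}\<^sup>*)"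

definition acyclic_graph :: "nat set set \<Rightarrow> bool" where
  "acyclic_graph E \<longleftrightarrow>
     \<not> (\<exists>xs. distinct xs \<and> 3 \<le> length xs \<and>
          (\<forall>k<length xs. {xs ! k, xs ! (Suc k mod length xs)} \<in> E))"

definition num_spanning_trees :: "nat \<Rightarrow> nat set set \<Rightarrow> nat" where
  "num_spanning_trees n E = card {F. F \<subseteq> E \<and> connected_graph n F \<and> acyclic_graph F}"

definition nbrs :: "nat set set \<Rightarrow> nat \<Rightarrow> nat set" where
  "nbrs E i = {j. {i, j} \<in> E}"

definition degree_mat :: "nat \<Rightarrow> nat set set \<Rightarrow> real mat" where
  "degree_mat n E = mat n n (\<lambda>(i, j). if i = j then real (card (nbrs E i)) else 0)"

definition adjacency_mat :: "nat \<Rightarrow> nat set set \<Rightarrow> real mat" where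
  "adjacency_mat n E = mat n n (\<lambda>(i, j). if {i, j} \<in> E then 1 else 0)"

definition laplacian :: "nat \<Rightarrow> nat set set \<Rightarrow> real mat" where
  "laplacian n E = degree_mat n E - adjacency_mat n E"

definition ones_mat :: "nat \<Rightarrow> real mat" where
  "ones_mat n = mat n n (\<lambda>_. 1)"

text \<open>The four Penrose equations, which determine \<open>X\<close> uniquely.\<close>

definition is_mp_inverse :: "real mat \<Rightarrow> real mat \<Rightarrow> bool" where
  "is_mp_inverse A X \<longleftrightarrow> X \<in> carrier_mat (dim_col A) (dim_row A) \<and>
     A * X * A = A \<and> X * A * X = X \<and>
     transpose_mat (A * X) = A * X \<and> transpose_mat (X * A) = X * A"

definition mp_inverse :: "real mat \<Rightarrow> real mat" where
  "mp_inverse A = (THE X. is_mp_inverse A X)"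

text \<open>
  \<open>p\<close> is an electric potential on the network in which every edge has unit resistance, when a unit
  current enters at \<open>i\<close> and leaves at \<open>j\<close>.  By Ohm's law the current along an edge from \<open>k\<close> to \<open>l\<close>
  is \<open>p k - p l\<close>; Kirchhoff's current law prescribes the net outflow at every vertex.
\<close>

definition unit_flow_potential ::
    "nat \<Rightarrow> nat set set \<Rightarrow> nat \<Rightarrow> nat \<Rightarrow> (nat \<Rightarrow> real) \<Rightarrow> bool" where
  "unit_flow_potential n E i j p \<longleftrightarrow>
     (\<forall>k<n. (\<Sum>l\<in>nbrs E k. p k - p l) = (if k = i then 1 else 0) - (if k = j then 1 else 0))"

text \<open>
  On a connected graph such a potential exists and is unique on the vertices up to an additive
  constant, so the potential difference below is well defined.
\<close>

definition resistance :: "nat \<Rightarrow> nat set set \<Rightarrow> nat \<Rightarrow> nat \<Rightarrow> real" where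
  "resistance n E i j = (THE r. \<exists>p. unit_flow_potential n E i j p \<and> r = p i - p j)"

definition resistance_mat :: "nat \<Rightarrow> nat set set \<Rightarrow> real mat" where
  "resistance_mat n E = mat n n (\<lambda>(i, j). resistance n E i j)"

definition resistance_regular :: "nat \<Rightarrow> nat set set \<Rightarrow> bool" where
  "resistance_regular n E \<longleftrightarrow> (\<exists>c. \<forall>i<n. (\<Sum>j<n. resistance_mat n E $$ (i, j)) = c)"

definition kirchhoff_index :: "nat \<Rightarrow> nat set set \<Rightarrow> real" where
  "kirchhoff_index n E = 1 / 2 * (\<Sum>i<n. \<Sum>j<n. resistance n E i j)"

definition bottleneck_mat :: "nat \<Rightarrow> nat set set \<Rightarrow> nat \<Rightarrow> real mat" where
  "bottleneck_mat n E v = the (mat_inverse (mat_delete (laplacian n E) v v))"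

text \<open>The plain sum of all entries, without absolute values.\<close>

definition entry_sum :: "real mat \<Rightarrow> real" where
  "entry_sum M = (\<Sum>i<dim_row M. \<Sum>j<dim_col M. M $$ (i, j))"

end

theory Submission
  imports Defs
begin

text \<open>
  With \<open>g\<close> the entries of the pseudoinverse, \<open>L g = I - J / n\<close>.  Hence \<open>r\<^sub>i\<^sub>j = g\<^sub>i\<^sub>i + g\<^sub>j\<^sub>j - 2 g\<^sub>i\<^sub>j\<close>, the
  \<open>i\<close>-th row sum of the resistance matrix is \<open>n g\<^sub>i\<^sub>i + tr g\<close>, and each condition says that the
  diagonal of \<open>g\<close> is constant: the bottleneck matrix at \<open>v\<close> has the entries
  \<open>g\<^sub>i\<^sub>j - g\<^sub>i\<^sub>v - g\<^sub>v\<^sub>j + g\<^sub>v\<^sub>v\<close> with sum \<open>n\<^sup>2 g\<^sub>v\<^sub>v\<close>, and by the matrix determinant lemma the principal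
  minor of \<open>L + J / n\<close> at \<open>v\<close> is \<open>det L(v) (1 + n g\<^sub>v\<^sub>v)\<close>, where \<open>det L(v) = t\<close> by the matrix-tree
  theorem.  The latter is proved for forests rooted at a set \<open>S\<close> of vertices: removing an edge \<open>a b\<close>
  with \<open>a \<in> S\<close>, \<open>b \<notin> S\<close> from a forest leaves a forest rooted at \<open>S \<union> {b}\<close>, so that deletion of edges
  alone, without contraction, gives a recursion, which the determinant satisfies as well.
\<close>

section \<open>Rooted spanning forests\<close>

abbreviation edge_rel :: "nat set set \<Rightarrow> (nat \<times> nat) set" where
  "edge_rel F \<equiv> {(x, y). {x, y} \<in> F}"

text \<open>
  A forest rooted at \<open>S\<close> is encoded as an edge set \<open>F\<close> with \<open>spans n F S\<close> and \<open>card F + card S = n\<close>.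
\<close>

definition spans :: "nat \<Rightarrow> nat set set \<Rightarrow> nat set \<Rightarrow> bool" where
  "spans n F S \<longleftrightarrow> (\<forall>u<n. \<exists>s\<in>S. (u, s) \<in> (edge_rel F)\<^sup>*)"

lemma edge_rel_rtrancl_mono: "F \<subseteq> F' \<Longrightarrow> (edge_rel F)\<^sup>* \<subseteq> (edge_rel F')\<^sup>*"
  by (rule rtrancl_mono) auto

lemma edge_rel_rtrancl_sym: "(u, v) \<in> (edge_rel F)\<^sup>* \<Longrightarrow> (v, u) \<in> (edge_rel F)\<^sup>*"
proof -
  have "sym (edge_rel F)"
    by (auto simp: sym_def insert_commute)
  then show "(u, v) \<in> (edge_rel F)\<^sup>* \<Longrightarrow> (v, u) \<in> (edge_rel F)\<^sup>*"
    by (meson sym_rtrancl symD)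
qed

lemma simple_graph_edge:
  assumes "simple_graph n E" "{a, b} \<in> E"
  shows "a < n" "b < n" "a \<noteq> b"
proof -
  have "{a, b} \<subseteq> {..<n}" "card {a, b} = 2"
    using assms by (auto simp: simple_graph_def)
  then show "a < n" "b < n" "a \<noteq> b"
    by auto
qed

lemma simple_graph_subset: "simple_graph n E \<Longrightarrow> F \<subseteq> E \<Longrightarrow> simple_graph n F"
  by (auto simp: simple_graph_def)

lemma simple_graph_finite: "simple_graph n E \<Longrightarrow> finite E"
  by (rule finite_subset[of _ "Pow {..<n}"]) (auto simp: simple_graph_def)

lemma connected_graph_iff_spans:
  assumes "r < n"
  shows "connected_graph n F \<longleftrightarrow> spans n F {r}"
proof
  show "connected_graph n F \<Longrightarrow> spans n F {r}"
    using assms by (auto simp: connected_graph_def spans_def)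
  assume "spans n F {r}"
  then show "connected_graph n F"
    using assms unfolding connected_graph_def spans_def
    by (auto intro: rtrancl_trans edge_rel_rtrancl_sym)
qed

lemma spans_mono: "spans n F S \<Longrightarrow> F \<subseteq> F' \<Longrightarrow> spans n F' S"
  unfolding spans_def using edge_rel_rtrancl_mono by blast

text \<open>A walk to the roots is followed until it is about to use the edge; it then stands in
  \<open>a\<close> or \<open>b\<close>, and both are roots on the right. Conversely, a walk that
  ends in \<open>b\<close> continues over the edge to \<open>a\<close>.\<close>

lemma spans_insert_edge_iff:
  assumes "a \<in> S" "{a, b} \<in> F"
  shows "spans n F S \<longleftrightarrow> spans n (F - {{a, b}}) (insert b S)"
proof
  assume span: "spans n F S"
  have "\<exists>w\<in>insert b S. (u, w) \<in> (edge_rel (F - {{a, b}}))\<^sup>*"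
    if "(u, s) \<in> (edge_rel F)\<^sup>*" "s \<in> S" for u s
    using that
  proof (induction rule: converse_rtrancl_induct)
    case base
    then show ?case by blast
  next
    case (step u v)
    show ?case
    proof (cases "{u, v} = {a, b}")
      case True
      then have "u \<in> insert b S"
        using assms(1) by (auto simp: doubleton_eq_iff)
      then show ?thesis by blast
    next
      case False
      then have "(u, v) \<in> edge_rel (F - {{a, b}})"
        using step.hyps by auto
      then show ?thesis
        using step.IH step.prems by (meson converse_rtrancl_into_rtrancl)
    qed
  qed
  then show "spans n (F - {{a, b}}) (insert b S)"
    using span unfolding spans_def by meson
next
  assume span: "spans n (F - {{a, b}}) (insert b S)"
  have ba: "(b, a) \<in> (edge_rel F)\<^sup>*"
    using assms(2) by (auto simp: insert_commute)
  show "spans n F S"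
    unfolding spans_def
  proof (intro allI impI)
    fix u assume "u < n"
    then obtain w where w: "w \<in> insert b S" "(u, w) \<in> (edge_rel F)\<^sup>*"
      using spans_mono[OF span, of F] by (auto simp: spans_def)
    then show "\<exists>s\<in>S. (u, s) \<in> (edge_rel F)\<^sup>*"
      using assms(1) ba by (cases "w = b") (auto intro: rtrancl_trans)
  qed
qed

lemma crossing_edge:
  assumes "(u, s) \<in> (edge_rel F)\<^sup>*" "s \<in> S" "u \<notin> S"
  shows "\<exists>a b. a \<in> S \<and> b \<notin> S \<and> {a, b} \<in> F"
  using assms
proof (induction rule: converse_rtrancl_induct)
  case (step u v)
  moreover have "{v, u} \<in> F"
    using step.hyps(1) by (simp add: insert_commute)
  ultimately show ?case by blast
qed simp

lemma spans_crossing_edge: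
  assumes "simple_graph n F" "spans n F S" "S \<subset> {..<n}"
  obtains a b where "a \<in> S" "b < n" "b \<notin> S" "{a, b} \<in> F"
proof -
  obtain u where "u < n" "u \<notin> S"
    using assms(3) by auto
  then show ?thesis
    using that crossing_edge[of u _ F S] assms(1,2) simple_graph_edge(2)
    unfolding spans_def by metis
qed

text \<open>An edge leaving the root set is removed and its outer end becomes a root; the forest
  found for the larger root set then gets the edge back. The number of vertices that are not roots
  drops each time, until every vertex is a root and the empty edge set suffices.\<close>

lemma spanning_forest_exists:
  assumes "simple_graph n F" "spans n F S" "S \<subseteq> {..<n}"
  shows "\<exists>T\<subseteq>F. spans n T S \<and> card T + card S = n"
  using assms
proof (induction "n - card S" arbitrary: F S rule: less_induct)
  case less
  show ?case
  proof (cases "S = {..<n}")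
    case True
    then show ?thesis by (auto simp: spans_def intro!: exI[of _ "{}"])
  next
    case False
    with less.prems obtain a b where ab: "a \<in> S" "b < n" "b \<notin> S" "{a, b} \<in> F"
      using spans_crossing_edge[of n F S] by blast
    have fin: "finite S"
      using less.prems(3) finite_subset by blast
    have "card S < n"
      using False less.prems(3) psubset_card_mono[of "{..<n}" S] by auto
    moreover have "simple_graph n (F - {{a, b}})"
      using less.prems(1) by (rule simple_graph_subset) auto
    ultimately obtain T where T: "T \<subseteq> F - {{a, b}}" "spans n T (insert b S)"
      "card T + card (insert b S) = n"
      using less.hyps[of "insert b S" "F - {{a, b}}"] less.prems ab fin
        spans_insert_edge_iff[OF ab(1,4)] by fastforce
    have finT: "finite T"
      using T(1) less.prems(1) simple_graph_finite finite_subset by blast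
    have "insert {a, b} T - {{a, b}} = T"
      using T(1) by blast
    then have "spans n (insert {a, b} T) S"
      using T(2) spans_insert_edge_iff[OF ab(1), of b "insert {a, b} T"] by simp
    moreover have "card (insert {a, b} T) + card S = n"
      using T(1,3) ab(3) fin finT by (subst card_insert_disjoint) auto
    ultimately show ?thesis
      using T(1) ab(4) by (intro exI[of _ "insert {a, b} T"]) auto
  qed
qed

section \<open>Paths, cycles and the number of edges of a tree\<close>

lemma simple_path_exists:
  assumes "(u, v) \<in> (edge_rel T)\<^sup>*"
  shows "\<exists>xs. xs \<noteq> [] \<and> distinct xs \<and> hd xs = u \<and> last xs = v \<and>
           (\<forall>k. Suc k < length xs \<longrightarrow> {xs ! k, xs ! Suc k} \<in> T)"
  using assms
proof (induction rule: converse_rtrancl_induct)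
  case base
  show ?case by (rule exI[of _ "[v]"]) auto
next
  case (step u w)
  then obtain xs where xs: "xs \<noteq> []" "distinct xs" "hd xs = w" "last xs = v"
    "\<And>k. Suc k < length xs \<Longrightarrow> {xs ! k, xs ! Suc k} \<in> T" by blast
  show ?case
  proof (cases "u \<in> set xs")
    case True
    then obtain i where i: "i < length xs" "xs ! i = u"
      by (auto simp: in_set_conv_nth)
    \<comment> \<open>If \<open>u\<close> already lies on the path, the part from \<open>u\<close>
      onwards is taken, so that the vertices stay distinct.\<close>
    then show ?thesis
      using xs by (intro exI[of _ "drop i xs"]) (auto simp: hd_drop_conv_nth)
  next
    case False
    have "{(u # xs) ! k, (u # xs) ! Suc k} \<in> T" if "Suc k < length (u # xs)" for k
      using that xs(1,3,5) step.hyps(1) by (cases k) (auto simp: hd_conv_nth)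
    then show ?thesis
      using False xs by (intro exI[of _ "u # xs"]) auto
  qed
qed

text \<open>\<open>F\<close> is compared with a spanning tree inside it. An edge outside this tree
  would close a cycle with the tree path between its ends. Conversely, an edge of a cycle can be
  deleted without losing connectivity, and then a spanning tree with \<open>n - 1\<close> edges
  would fit into a set of \<open>n - 2\<close> edges.\<close>

lemma acyclic_connected_iff_card:
  assumes "simple_graph n F" "connected_graph n F"
  shows "acyclic_graph F \<longleftrightarrow> card F + 1 = n"
proof
  have n: "0 < n"
    using assms(2) by (simp add: connected_graph_def)
  assume acyc: "acyclic_graph F"
  obtain T where T: "T \<subseteq> F" "spans n T {0}" "card T + 1 = n"
    using spanning_forest_exists[of n F "{0}"] assms n connected_graph_iff_spans[OF n] by auto
  have "F \<subseteq> T"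
  proof
    fix e assume e: "e \<in> F"
    then obtain u v where uv: "e = {u, v}"
      using assms(1) by (metis card_2_iff simple_graph_def)
    have uvn: "u < n" "v < n" "u \<noteq> v"
      using simple_graph_edge[OF assms(1)] e uv by auto
    have "(u, v) \<in> (edge_rel T)\<^sup>*"
      using T(2) uvn connected_graph_iff_spans[OF n, of T] by (auto simp: connected_graph_def)
    then obtain xs where xs: "xs \<noteq> []" "distinct xs" "hd xs = u" "last xs = v"
      "\<And>k. Suc k < length xs \<Longrightarrow> {xs ! k, xs ! Suc k} \<in> T"
      using simple_path_exists[of u v T] by blast
    show "e \<in> T"
    proof (rule ccontr)
      assume nT: "e \<notin> T"
      \<comment> \<open>A path with one vertex would give \<open>u = v\<close>, and one with two
        vertices would make \<open>e\<close> an edge of \<open>T\<close>.\<close>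
      have "length xs \<noteq> 0" "length xs \<noteq> 1" "length xs \<noteq> 2"
        using xs uvn nT uv by (auto simp: length_Suc_conv numeral_2_eq_2)
      then have len: "3 \<le> length xs" by linarith
      have "{xs ! k, xs ! (Suc k mod length xs)} \<in> F" if k: "k < length xs" for k
      proof (cases "Suc k < length xs")
        case True
        then show ?thesis using xs(5) T(1) by auto
      next
        case False
        \<comment> \<open>The last index wraps around to 0: the cycle closes along \<open>e\<close>,
          from \<open>v\<close> back to \<open>u\<close>.\<close>
        then have "k = length xs - 1" using k by simp
        then have "xs ! k = v" "xs ! (Suc k mod length xs) = u"
          using xs by (auto simp: last_conv_nth hd_conv_nth)
        then show ?thesis using e uv by (simp add: insert_commute)
      qed
      then show False
        using acyc xs(2) len unfolding acyclic_graph_def by blast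
    qed
  qed
  then show "card F + 1 = n"
    using T by auto
next
  assume card: "card F + 1 = n"
  show "acyclic_graph F"
    unfolding acyclic_graph_def
  proof
    assume "\<exists>xs. distinct xs \<and> 3 \<le> length xs \<and>
          (\<forall>k<length xs. {xs ! k, xs ! (Suc k mod length xs)} \<in> F)"
    then obtain xs where xs: "distinct xs" "3 \<le> length xs"
      "\<And>k. k < length xs \<Longrightarrow> {xs ! k, xs ! (Suc k mod length xs)} \<in> F" by blast
    \<comment> \<open>\<open>{?b, ?a}\<close> is the closing edge of the cycle; the remaining edges
      still join its two ends.\<close>
    let ?a = "xs ! 0" and ?b = "xs ! (length xs - 1)"
    let ?F = "F - {{?b, ?a}}"
    have ba: "{?b, ?a} \<in> F"
      using xs(3)[of "length xs - 1"] xs(2) by (cases "length xs") auto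
    have "xs \<noteq> []" using xs(2) by auto
    note nodes = simple_graph_edge[OF assms(1) ba]
    have path: "(?a, xs ! k) \<in> (edge_rel ?F)\<^sup>*" if "k < length xs" for k
      using that
    proof (induction k)
      case (Suc k)
      have "{xs ! k, xs ! Suc k} \<in> F"
        using xs(3)[of k] Suc.prems by simp
      \<comment> \<open>An inner step that equals the closing edge would lead from index 0 straight
        to the last index, which \<open>3 \<le> length xs\<close> excludes.\<close>
      moreover have "{xs ! k, xs ! Suc k} \<noteq> {?b, ?a}"
      proof
        assume "{xs ! k, xs ! Suc k} = {?b, ?a}"
        moreover have "xs ! Suc k \<noteq> ?a"
          using xs(1) \<open>xs \<noteq> []\<close> Suc.prems nth_eq_iff_index_eq[of xs "Suc k" 0] by auto
        ultimately have "xs ! k = ?a" "xs ! Suc k = ?b"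
          by (auto simp: doubleton_eq_iff)
        then show False
          using xs(1,2) \<open>xs \<noteq> []\<close> Suc.prems nth_eq_iff_index_eq[of xs k 0]
            nth_eq_iff_index_eq[of xs "Suc k" "length xs - 1"] by auto
      qed
      ultimately have "(xs ! k, xs ! Suc k) \<in> edge_rel ?F" by auto
      then show ?case
        using Suc by (meson Suc_lessD rtrancl.rtrancl_into_rtrancl)
    qed simp
    have "spans n ?F (insert ?a {?b})"
      using assms(2) spans_insert_edge_iff[of ?b "{?b}" ?a F n]
        connected_graph_iff_spans[OF nodes(1)] ba by blast
    moreover have "(?a, ?b) \<in> (edge_rel ?F)\<^sup>*"
      using path[of "length xs - 1"] xs(2) by auto
    ultimately have "spans n ?F {?b}"
      unfolding spans_def by (auto intro: rtrancl_trans)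
    moreover have simp: "simple_graph n ?F"
      using assms(1) by (rule simple_graph_subset) auto
    ultimately obtain T where "T \<subseteq> ?F" "card T + 1 = n"
      using spanning_forest_exists[of n ?F "{?b}"] nodes(1) by auto
    then have "n \<le> card ?F + 1"
      using card_mono[of ?F T] simple_graph_finite[OF simp] by auto
    moreover have "card ?F < card F"
      using ba simple_graph_finite[OF assms(1)] by (rule card_Diff1_less[rotated])
    ultimately show False
      using card by simp
  qed
qed

lemma num_spanning_trees_eq:
  assumes "simple_graph n E" "r < n"
  shows "num_spanning_trees n E = card {F. F \<subseteq> E \<and> spans n F {r} \<and> card F + card {r} = n}"
proof -
  have "connected_graph n F \<and> acyclic_graph F \<longleftrightarrow> spans n F {r} \<and> card F + card {r} = n"
    if "F \<subseteq> E" for F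
    using acyclic_connected_iff_card[of n F] simple_graph_subset[OF assms(1) that]
      connected_graph_iff_spans[OF assms(2), of F] by auto
  then show ?thesis
    unfolding num_spanning_trees_def by metis
qed

section \<open>The matrix-tree theorem\<close>

text \<open>
  The Laplacian with the rows and columns in \<open>S\<close> replaced by unit vectors: this has the determinant
  of the submatrix without them, but keeps the order \<open>n\<close> while \<open>S\<close> grows.
\<close>

definition grounded :: "nat \<Rightarrow> nat set set \<Rightarrow> nat set \<Rightarrow> real mat" where
  "grounded n E S = mat n n (\<lambda>(i, j).
     if i \<in> S \<or> j \<in> S then (if i = j then 1 else 0) else laplacian n E $$ (i, j))"

section \<open>Entries of the Laplacian and its action on potentials\<close>

lemma laplacian_carrier [simp]: "laplacian n E \<in> carrier_mat n n"
  by (auto simp: laplacian_def degree_mat_def adjacency_mat_def)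

lemma laplacian_dim [simp]: "dim_row (laplacian n E) = n" "dim_col (laplacian n E) = n"
  by (simp_all add: laplacian_def degree_mat_def adjacency_mat_def)

lemma laplacian_index:
  "i < n \<Longrightarrow> j < n \<Longrightarrow> laplacian n E $$ (i, j) =
     (if i = j then real (card (nbrs E i)) else 0) - (if {i, j} \<in> E then 1 else 0)"
  by (simp add: laplacian_def degree_mat_def adjacency_mat_def)

lemma laplacian_sym: "i < n \<Longrightarrow> j < n \<Longrightarrow> laplacian n E $$ (i, j) = laplacian n E $$ (j, i)"
  by (simp add: laplacian_index insert_commute)

lemma grounded_carrier [simp]: "grounded n E S \<in> carrier_mat n n"
  by (simp add: grounded_def)

lemma nbrs_subset: "simple_graph n E \<Longrightarrow> nbrs E i \<subseteq> {..<n}"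
  using simple_graph_edge(2)[of n E i] by (auto simp: nbrs_def)

lemma finite_nbrs: "simple_graph n E \<Longrightarrow> finite (nbrs E i)"
  using finite_subset[OF nbrs_subset] by simp

lemma laplacian_apply:
  assumes "simple_graph n E" "i < n"
  shows "(\<Sum>j<n. laplacian n E $$ (i, j) * p j) = (\<Sum>j\<in>nbrs E i. p i - p j)"
proof -
  have "(\<Sum>j<n. laplacian n E $$ (i, j) * p j) =
      (\<Sum>j<n. (if i = j then real (card (nbrs E i)) * p i else 0)) -
      (\<Sum>j<n. if {i, j} \<in> E then p j else 0)"
    unfolding sum_subtractf[symmetric]
    using assms(2) by (intro sum.cong) (auto simp: laplacian_index left_diff_distrib)
  also have "(\<Sum>j<n. if {i, j} \<in> E then p j else 0) = (\<Sum>j\<in>nbrs E i. p j)"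
    using nbrs_subset[OF assms(1), of i]
    by (subst sum.inter_filter[symmetric]) (auto simp: nbrs_def intro!: sum.cong)
  finally show ?thesis
    using assms(2) by (simp add: sum_subtractf)
qed

text \<open>In the expansion along row \<open>v\<close> the cofactors do not see the only entry that
  differs.\<close>

lemma det_diag_perturb:
  fixes A B :: "'a :: comm_ring_1 mat"
  assumes A: "A \<in> carrier_mat n n" and B: "B \<in> carrier_mat n n" and v: "v < n"
    and eq: "\<And>i j. i < n \<Longrightarrow> j < n \<Longrightarrow> (i, j) \<noteq> (v, v) \<Longrightarrow> A $$ (i, j) = B $$ (i, j)"
  shows "det A = det B + (A $$ (v, v) - B $$ (v, v)) * det (mat_delete B v v)"
proof -
  have "mat_delete A v j = mat_delete B v j" for j
    using A B v eq by (intro eq_matI) (auto simp: mat_delete_def)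
  then have cof: "cofactor A v j = cofactor B v j" for j
    by (simp add: cofactor_def)
  have "det A = (\<Sum>j<n. A $$ (v, j) * cofactor B v j)"
    using laplace_expansion_row[OF A v] cof by simp
  also have "\<dots> = (\<Sum>j<n. B $$ (v, j) * cofactor B v j +
      (if j = v then (A $$ (v, v) - B $$ (v, v)) * cofactor B v v else 0))"
    using eq v by (intro sum.cong) (auto simp: algebra_simps)
  also have "\<dots> = det B + (A $$ (v, v) - B $$ (v, v)) * cofactor B v v"
    using laplace_expansion_row[OF B v] v by (simp add: sum.distrib)
  finally show ?thesis
    by (simp add: cofactor_def)
qed

lemma det_unit_row:
  fixes A :: "'a :: comm_ring_1 mat"
  assumes A: "A \<in> carrier_mat n n" and v: "v < n"
    and row: "\<And>j. j < n \<Longrightarrow> A $$ (v, j) = (if v = j then 1 else 0)"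
  shows "det A = det (mat_delete A v v)"
proof -
  have "det A = (\<Sum>j<n. if v = j then cofactor A v v else 0)"
    unfolding laplace_expansion_row[OF A v] using row by (intro sum.cong) auto
  then show ?thesis
    using v by (simp add: cofactor_def)
qed

text \<open>The indicator vector of the complement of \<open>S\<close> lies in the kernel: a vertex
  outside \<open>S\<close> has all its neighbours outside \<open>S\<close>, so the differences in
  its Laplacian row vanish.\<close>

lemma det_grounded_no_crossing_edge:
  assumes "simple_graph n E" "S \<subset> {..<n}"
    and no_edge: "\<And>a b. a \<in> S \<Longrightarrow> b \<notin> S \<Longrightarrow> {a, b} \<notin> E"
  shows "det (grounded n E S) = 0"
proof -
  define x where "x = vec n (\<lambda>i. if i \<in> S then 0 else 1 :: real)"
  obtain u where u: "u < n" "u \<notin> S" using assms(2) by auto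
  then have "x $ u \<noteq> 0\<^sub>v n $ u" by (simp add: x_def)
  then have nz: "x \<noteq> 0\<^sub>v n" by auto
  have "(\<Sum>j<n. grounded n E S $$ (i, j) * x $ j) = 0" if i: "i < n" for i
  proof (cases "i \<in> S")
    case True
    then show ?thesis
      using i by (intro sum.neutral) (auto simp: grounded_def x_def)
  next
    case False
    have "(\<Sum>j<n. grounded n E S $$ (i, j) * x $ j) =
        (\<Sum>j<n. laplacian n E $$ (i, j) * (if j \<in> S then 0 else 1))"
      using i False by (intro sum.cong) (auto simp: grounded_def x_def)
    also have "\<dots> = 0"
      using laplacian_apply[OF assms(1) i, of "\<lambda>j. if j \<in> S then 0 else 1"] False no_edge[of _ i]
      by (auto simp: nbrs_def insert_commute intro!: sum.neutral)
    finally show ?thesis .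
  qed
  then have "grounded n E S *\<^sub>v x = 0\<^sub>v n"
    by (intro eq_vecI) (auto simp: x_def scalar_prod_def grounded_def atLeast0LessThan)
  moreover have "x \<in> carrier_vec n" by (simp add: x_def)
  ultimately show ?thesis
    using nz unfolding det_0_iff_vec_prod_zero[OF grounded_carrier] by blast
qed

text \<open>Row and column \<open>a\<close> are unit vectors already, so deleting the edge only
  lowers the diagonal entry at \<open>b\<close> by one. The minor that this entry multiplies is the
  determinant with \<open>b\<close> grounded as well.\<close>

lemma det_grounded_remove_edge:
  assumes "simple_graph n E" "S \<subseteq> {..<n}" "a \<in> S" "b \<notin> S" and e: "{a, b} \<in> E"
  shows "det (grounded n E S) =
    det (grounded n (E - {{a, b}}) S) + det (grounded n (E - {{a, b}}) (insert b S))"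
proof -
  let ?E = "E - {{a, b}}"
  note nodes = simple_graph_edge[OF assms(1) e]
  have "nbrs ?E b = nbrs E b - {a}"
    by (auto simp: nbrs_def doubleton_eq_iff)
  moreover have "a \<in> nbrs E b"
    using e by (simp add: nbrs_def insert_commute)
  ultimately have "card (nbrs E b) = Suc (card (nbrs ?E b))"
    using finite_nbrs[OF assms(1), of b] by (metis card_Suc_Diff1)
  then have diag: "grounded n E S $$ (b, b) - grounded n ?E S $$ (b, b) = 1"
    using assms(4) nodes by (simp add: grounded_def laplacian_index)
  have nbrs: "nbrs ?E i = nbrs E i" if "i \<noteq> a" "i \<noteq> b" for i
    using that by (auto simp: nbrs_def doubleton_eq_iff)
  have "grounded n E S $$ (i, j) = grounded n ?E S $$ (i, j)"
    if "i < n" "j < n" "(i, j) \<noteq> (b, b)" for i j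
    using that assms(3) nbrs[of i]
    by (cases "i = a") (auto simp: grounded_def laplacian_index doubleton_eq_iff)
  then have "det (grounded n E S) = det (grounded n ?E S) + det (mat_delete (grounded n ?E S) b b)"
    using det_diag_perturb[OF grounded_carrier grounded_carrier nodes(2), of E S ?E S] diag by simp
  moreover have "mat_delete (grounded n ?E S) b b = mat_delete (grounded n ?E (insert b S)) b b"
    by (intro eq_matI) (auto simp: mat_delete_def grounded_def)
  moreover have "det (grounded n ?E (insert b S)) = det (mat_delete (grounded n ?E (insert b S)) b b)"
    using nodes(2) by (intro det_unit_row[OF grounded_carrier]) (auto simp: grounded_def)
  ultimately show ?thesis by simp
qed

text \<open>The forests are split by whether they contain the edge. Those that do correspond to
  forests rooted also at \<open>b\<close>: one edge fewer, one root more, so the count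
  \<open>card F + card S\<close> is kept.\<close>

lemma spanning_forests_remove_edge:
  assumes "simple_graph n E" "S \<subseteq> {..<n}" "a \<in> S" "b \<notin> S" and e: "{a, b} \<in> E"
  defines "forests \<equiv> \<lambda>E S. {F. F \<subseteq> E \<and> spans n F S \<and> card F + card S = n}"
  shows "card (forests E S) =
    card (forests (E - {{a, b}}) S) + card (forests (E - {{a, b}}) (insert b S))"
proof -
  let ?e = "{a, b}"
  have finE: "finite E" using assms(1) by (rule simple_graph_finite)
  have cardS: "card (insert b S) = Suc (card S)"
    using assms(2,4) finite_subset by (subst card_insert_disjoint) auto
  have iff: "insert ?e F \<in> forests E S \<longleftrightarrow> F \<in> forests (E - {?e}) (insert b S)"
    if "?e \<notin> F" for F
  proof -
    have "card (insert ?e F) = Suc (card F)" if "F \<subseteq> E"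
      using that \<open>?e \<notin> F\<close> finE finite_subset by (simp add: card_insert_disjoint finite_subset)
    moreover have "F \<subseteq> E - {?e} \<longleftrightarrow> F \<subseteq> E" using that by blast
    ultimately show ?thesis
      using that spans_insert_edge_iff[OF assms(3), of b "insert ?e F" n] cardS e
      unfolding forests_def by auto
  qed
  have "forests E S = forests (E - {?e}) S \<union> insert ?e ` forests (E - {?e}) (insert b S)"
  proof (intro equalityI subsetI)
    fix F assume F: "F \<in> forests E S"
    show "F \<in> forests (E - {?e}) S \<union> insert ?e ` forests (E - {?e}) (insert b S)"
    proof (cases "?e \<in> F")
      case True
      then have id: "insert ?e (F - {?e}) = F" by auto
      then have "F - {?e} \<in> forests (E - {?e}) (insert b S)"
        using F iff[of "F - {?e}"] by simp
      then show ?thesis using id by (metis UnCI imageI)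
    next
      case False
      then show ?thesis using F by (auto simp: forests_def)
    qed
  next
    fix F assume "F \<in> forests (E - {?e}) S \<union> insert ?e ` forests (E - {?e}) (insert b S)"
    then show "F \<in> forests E S"
    proof
      assume "F \<in> forests (E - {?e}) S"
      then show ?thesis by (auto simp: forests_def)
    next
      assume "F \<in> insert ?e ` forests (E - {?e}) (insert b S)"
      then obtain F' where F': "F = insert ?e F'" "F' \<in> forests (E - {?e}) (insert b S)" by auto
      then have "?e \<notin> F'" by (auto simp: forests_def)
      then show ?thesis using F' iff by simp
    qed
  qed
  moreover have "finite (forests E' S')" if "E' \<subseteq> E" for E' S'
    by (rule finite_subset[of _ "Pow E"]) (use that finE in \<open>auto simp: forests_def\<close>)
  then have "finite (forests (E - {?e}) S)" "finite (forests (E - {?e}) (insert b S))"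
    by simp_all
  moreover have "forests (E - {?e}) S \<inter> insert ?e ` forests (E - {?e}) (insert b S) = {}"
    by (auto simp: forests_def)
  moreover have "inj_on (insert ?e) (forests (E - {?e}) (insert b S))"
  proof (rule inj_onI)
    fix F F'
    assume "F \<in> forests (E - {?e}) (insert b S)" "F' \<in> forests (E - {?e}) (insert b S)"
    then have "?e \<notin> F" "?e \<notin> F'"
      by (auto simp: forests_def)
    then show "insert ?e F = insert ?e F' \<Longrightarrow> F = F'"
      by (simp add: insert_ident)
  qed
  ultimately show ?thesis
    by (simp add: card_Un_disjoint card_image)
qed

text \<open>Both sides obey the same recursion under edge deletion. It ends when all vertices are
  roots, where both sides are 1, or when no edge leaves \<open>S\<close> although other vertices
  remain, where both are 0.\<close>

theorem det_grounded:
  assumes "simple_graph n E" "S \<subseteq> {..<n}"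
  shows "det (grounded n E S) = real (card {F. F \<subseteq> E \<and> spans n F S \<and> card F + card S = n})"
  using assms
proof (induction "card E" arbitrary: E S rule: less_induct)
  case less
  note simple = less.prems(1) and finE = simple_graph_finite[OF less.prems(1)]
  consider "S = {..<n}" | "S \<subset> {..<n}" "\<And>a b. a \<in> S \<Longrightarrow> b \<notin> S \<Longrightarrow> {a, b} \<notin> E"
    | a b where "a \<in> S" "b \<notin> S" "{a, b} \<in> E"
    using less.prems(2) by blast
  then show ?case
  proof cases
    case 1
    have "grounded n E S = 1\<^sub>m n"
      using 1 by (intro eq_matI) (auto simp: grounded_def)
    moreover have "{F. F \<subseteq> E \<and> spans n F S \<and> card F + card S = n} = {{}}"
      using 1 finE by (auto simp: spans_def dest: finite_subset)
    ultimately show ?thesis by simp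
  next
    case 2
    have "\<not> spans n F S" if "F \<subseteq> E" for F
    proof
      assume "spans n F S"
      with simple_graph_subset[OF simple that] obtain a b where "a \<in> S" "b \<notin> S" "{a, b} \<in> F"
        using 2(1) by (rule spans_crossing_edge)
      then show False
        using 2(2) that by blast
    qed
    then have "{F. F \<subseteq> E \<and> spans n F S \<and> card F + card S = n} = {}" by blast
    moreover have "det (grounded n E S) = 0"
      using det_grounded_no_crossing_edge[OF simple 2(1)] 2(2) by blast
    ultimately show ?thesis by (simp only: card.empty of_nat_0)
  next
    case 3
    have "card (E - {{a, b}}) < card E"
      using 3(3) finE by (rule card_Diff1_less[rotated])
    moreover have "simple_graph n (E - {{a, b}})"
      using simple by (rule simple_graph_subset) auto
    moreover have "insert b S \<subseteq> {..<n}"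
      using less.prems(2) simple_graph_edge(2)[OF simple 3(3)] by simp
    ultimately show ?thesis
      using less.hyps[of "E - {{a, b}}" S] less.hyps[of "E - {{a, b}}" "insert b S"]
        det_grounded_remove_edge[OF less.prems 3] spanning_forests_remove_edge[OF less.prems 3]
        less.prems(2) by simp
  qed
qed

theorem matrix_tree:
  assumes "simple_graph n E" "v < n"
  shows "det (mat_delete (laplacian n E) v v) = real (num_spanning_trees n E)"
proof -
  have "mat_delete (laplacian n E) v v = mat_delete (grounded n E {v}) v v"
    using assms(2) by (intro eq_matI) (auto simp: mat_delete_def grounded_def)
  also have "det \<dots> = det (grounded n E {v})"
    using assms(2) by (intro det_unit_row[OF grounded_carrier, symmetric]) (auto simp: grounded_def)
  finally show ?thesis
    using det_grounded[OF assms(1), of "{v}"] num_spanning_trees_eq[OF assms] assms(2) by simp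
qed

section \<open>Matrix inverses and determinants\<close>

text \<open>Since \<open>A * Y * A = A\<close>, the product \<open>(A * Y) * (A * X)\<close> is
  \<open>A * X\<close>; by symmetry of both factors it is also the transpose of
  \<open>(A * X) * (A * Y) = A * Y\<close>. Hence \<open>A * X = A * Y\<close>, likewise
  \<open>X * A = Y * A\<close>, and \<open>X * A * X\<close> can be turned into
  \<open>Y * A * Y\<close>.\<close>

lemma mp_inverse_unique:
  assumes X: "is_mp_inverse A X" and Y: "is_mp_inverse A Y"
  shows "X = Y"
proof -
  define r c where "r = dim_row A" and "c = dim_col A"
  have A: "A \<in> carrier_mat r c" by (simp add: r_def c_def)
  have cX: "X \<in> carrier_mat c r" and cY: "Y \<in> carrier_mat c r"
    using X Y by (simp_all add: is_mp_inverse_def r_def c_def)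
  note [simp] = assoc_mult_mat[of _ r c _ r _ c] assoc_mult_mat[of _ c r _ c _ r]
    assoc_mult_mat[of _ r c _ r _ r] assoc_mult_mat[of _ c r _ c _ c]
    assoc_mult_mat[of _ r c _ c _ r] assoc_mult_mat[of _ c r _ r _ c]
    assoc_mult_mat[of _ r c _ c _ c] assoc_mult_mat[of _ c r _ r _ r]
  note eqX = X[unfolded is_mp_inverse_def] and eqY = Y[unfolded is_mp_inverse_def]
  have "A * X = (A * Y * A) * X" using eqY by simp
  also have "\<dots> = (A * Y) * (A * X)" using A cX cY by simp
  also have "\<dots> = transpose_mat ((A * X) * (A * Y))"
    using A cX cY eqX eqY by (subst transpose_mult[of _ r r _ r]) auto
  also have "(A * X) * (A * Y) = (A * X * A) * Y" using A cX cY by simp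
  also have "transpose_mat \<dots> = A * Y" using eqX eqY by simp
  finally have AXY: "A * X = A * Y" .
  have "X * A = X * (A * Y * A)" using eqY by simp
  also have "\<dots> = (X * A) * (Y * A)" using A cX cY by simp
  also have "\<dots> = transpose_mat ((Y * A) * (X * A))"
    using A cX cY eqX eqY by (subst transpose_mult[of _ c c _ c]) auto
  also have "(Y * A) * (X * A) = Y * (A * X * A)" using A cX cY by simp
  also have "transpose_mat \<dots> = Y * A" using eqX eqY by simp
  finally have XAY: "X * A = Y * A" .
  have "X = X * A * X" using eqX by simp
  also have "\<dots> = X * (A * Y)" using A cX cY AXY by simp
  also have "\<dots> = Y * A * Y" using A cX cY XAY by (metis assoc_mult_mat)
  also have "\<dots> = Y" using eqY by simp
  finally show ?thesis .
qed

lemma mp_inverse_eqI: "is_mp_inverse A X \<Longrightarrow> mp_inverse A = X"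
  unfolding mp_inverse_def by (blast intro: mp_inverse_unique)

text \<open>A right inverse of a square matrix is two-sided, so \<open>A\<close> is a unit and
  \<open>mat_inverse\<close> does not fail; cancelling \<open>A\<close> with \<open>B\<close>
  identifies its result.\<close>

lemma mat_inverse_eqI:
  fixes A B :: "'a :: field mat"
  assumes A: "A \<in> carrier_mat m m" and B: "B \<in> carrier_mat m m" and AB: "A * B = 1\<^sub>m m"
  shows "mat_inverse A = Some B"
proof -
  have BA: "B * A = 1\<^sub>m m"
    using mat_mult_left_right_inverse[OF A B AB] .
  show ?thesis
  proof (cases "mat_inverse A")
    case None
    then have "A \<notin> Units (ring_mat TYPE('a) m ())"
      by (rule mat_inverse(1)[OF A])
    then show ?thesis
      using A B AB BA by (auto simp: Units_def ring_mat_def)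
  next
    case (Some C)
    then have "A * C = 1\<^sub>m m" "C \<in> carrier_mat m m"
      using mat_inverse(2)[OF A] by auto
    then have "C = B"
      using assoc_mult_mat[OF B A, of C m] BA B by simp
    then show ?thesis
      using Some by simp
  qed
qed

section \<open>Deleted rows and columns, and rank-one updates of determinants\<close>

lemma sum_insert_index:
  assumes "v < n"
  shows "(\<Sum>j<n - 1. f (insert_index v j)) = (\<Sum>j\<in>{..<n} - {v}. f j)"
proof -
  \<comment> \<open>\<open>insert_index v\<close> skips \<open>v\<close>: it sends indices of the
    matrix without row and column \<open>v\<close> to those of the full matrix.\<close>
  have "bij_betw (insert_index v) {..<n - 1} ({..<n} - {v})"
    using assms by (intro bij_betw_byWitness[where f' = "delete_index v"])
      (auto simp: insert_index_def delete_index_def)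
  then show ?thesis
    by (rule sum.reindex_bij_betw)
qed

lemma mat_delete_index_insert:
  assumes "A \<in> carrier_mat n n" "i < n - 1" "j < n - 1"
  shows "mat_delete A v v $$ (i, j) = A $$ (insert_index v i, insert_index v j)"
  using assms by (simp add: mat_delete_def insert_index_def)

text \<open>Both block products start from the bordered matrix with block rows \<open>(A, -U)\<close> and \<open>(V, 1)\<close>.\<close>

lemma det_rank_one_update:
  fixes A B U V :: "'a :: idom mat"
  assumes A: "A \<in> carrier_mat m m" and B: "B \<in> carrier_mat m m" and AB: "A * B = 1\<^sub>m m"
    and U: "U \<in> carrier_mat m 1" and V: "V \<in> carrier_mat 1 m"
  shows "det (A + U * V) = det A * (1 + (V * B * U) $$ (0, 0))"
proof -
  let ?M = "four_block_mat A (- U) V (1\<^sub>m 1)"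
  \<comment> \<open>Unitriangular column operations: \<open>?P\<close> clears the block
    \<open>V\<close> and \<open>?Q\<close> clears the block \<open>- U\<close>, so the determinant
    of \<open>?M\<close> can be read off in two ways.\<close>
  let ?P = "four_block_mat (1\<^sub>m m) (0\<^sub>m m 1) (- V) (1\<^sub>m 1)"
  let ?Q = "four_block_mat (1\<^sub>m m) (B * U) (0\<^sub>m 1 m) (1\<^sub>m 1)"
  have M: "?M \<in> carrier_mat (m + 1) (m + 1)"
    using A by (rule four_block_carrier_mat) simp
  have P: "?P \<in> carrier_mat (m + 1) (m + 1)" and Q: "?Q \<in> carrier_mat (m + 1) (m + 1)"
    by (rule four_block_carrier_mat; simp)+
  have "A * 1\<^sub>m m + - U * - V = A + U * V"
    using A U V by (intro eq_matI) (auto simp: scalar_prod_def)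
  then have "?M * ?P = four_block_mat (A + U * V) (- U) (0\<^sub>m 1 m) (1\<^sub>m 1)"
    using A U V by (subst mult_four_block_mat[of _ m m _ 1 _ 1]) auto
  moreover have "det \<dots> = det (A + U * V)"
    using A U V by (subst det_four_block_mat_lower_left_zero[of _ m _ 1]) auto
  moreover have "det ?P = 1"
    using V by (subst det_four_block_mat_upper_right_zero[of _ m _ 1]) auto
  ultimately have detM: "det ?M = det (A + U * V)"
    using det_mult[OF M P] by simp
  have ABU: "A * (B * U) = U"
    using assoc_mult_mat[OF A B U] AB U by simp
  have VBU: "V * (B * U) = V * B * U"
    using V B U by simp
  have "?M * ?Q = four_block_mat A (0\<^sub>m m 1) V (V * B * U + 1\<^sub>m 1)"
    using A B U V ABU VBU by (subst mult_four_block_mat[of _ m m _ 1 _ 1]) auto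
  moreover have "det \<dots> = det A * det (V * B * U + 1\<^sub>m 1)"
    using A B U V by (intro det_four_block_mat_upper_right_zero[of _ m _ 1]) auto
  moreover have "det ?Q = 1"
    using B U by (subst det_four_block_mat_lower_left_zero[of _ m _ 1]) auto
  ultimately have "det ?M = det A * det (V * B * U + 1\<^sub>m 1)"
    using det_mult[OF M Q] by simp
  moreover have "det (V * B * U + 1\<^sub>m 1) = 1 + (V * B * U) $$ (0, 0)"
    using V B U by (subst det_single) auto
  ultimately show ?thesis
    using detM by simp
qed

text \<open>The added matrix is a column of \<open>x\<close> times a row of ones, and a row of ones
  times \<open>B\<close> times a column of ones is the sum of the entries of
  \<open>B\<close>.\<close>

lemma det_add_const:
  fixes A B :: "real mat"
  assumes A: "A \<in> carrier_mat m m" and B: "B \<in> carrier_mat m m" and AB: "A * B = 1\<^sub>m m"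
  shows "det (A + x \<cdot>\<^sub>m ones_mat m) = det A * (1 + x * entry_sum B)"
proof -
  let ?U = "mat m 1 (\<lambda>_. x)" and ?V = "mat 1 m (\<lambda>_. 1 :: real)"
  have "x \<cdot>\<^sub>m ones_mat m = ?U * ?V"
    by (intro eq_matI) (auto simp: ones_mat_def scalar_prod_def)
  moreover have "(?V * B * ?U) $$ (0, 0) = x * entry_sum B"
  proof -
    have "(?V * B * ?U) $$ (0, 0) = (\<Sum>j<m. (\<Sum>i<m. B $$ (i, j)) * x)"
      using B by (auto simp: scalar_prod_def atLeast0LessThan intro!: sum.cong)
    also have "\<dots> = x * entry_sum B"
      using B by (subst sum_distrib_right[symmetric], subst sum.swap) (simp add: entry_sum_def)
    finally show ?thesis .
  qed
  ultimately show ?thesis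
    using det_rank_one_update[OF A B AB, of ?U ?V] by simp
qed

section \<open>The pseudoinverse of the Laplacian\<close>

text \<open>Maximum principle: the set on which \<open>p\<close> attains its maximum is closed under adjacency.\<close>

lemma laplacian_kernel:
  assumes simple: "simple_graph n E" and conn: "connected_graph n E"
    and ker: "\<And>i. i < n \<Longrightarrow> (\<Sum>j<n. laplacian n E $$ (i, j) * p j) = 0"
    and uv: "u < n" "v < n"
  shows "p u = p v"
proof -
  have "Max (p ` {..<n}) \<in> p ` {..<n}"
    using uv by (intro Max_in) auto
  then obtain w where w: "w < n" "p w = Max (p ` {..<n})" by auto
  have le: "p i \<le> p w" if "i < n" for i
    using that w(2) by simp
  have "p i = p w" if "(w, i) \<in> (edge_rel E)\<^sup>*" for i
    using that
  proof (induction rule: rtrancl_induct)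
    case (step i j)
    then have e: "{i, j} \<in> E" by simp
    note ij = simple_graph_edge[OF simple e]
    have "(\<Sum>l\<in>nbrs E i. p i - p l) = 0"
      using ker[OF ij(1)] laplacian_apply[OF simple ij(1)] by simp
    \<comment> \<open>As \<open>p i\<close> is maximal, the terms of this vanishing sum are
      nonnegative, so each of them is zero.\<close>
    moreover have "0 \<le> p i - p l" if "l \<in> nbrs E i" for l
      using le[of l] that nbrs_subset[OF simple, of i] step.IH by auto
    ultimately have "p i - p j = 0"
      using sum_nonneg_eq_0_iff[of "nbrs E i" "\<lambda>l. p i - p l"] finite_nbrs[OF simple, of i] e
      by (auto simp: nbrs_def)
    then show ?case using step.IH by simp
  qed simp
  then have "p u = p w" "p v = p w"
    using conn uv w(1) unfolding connected_graph_def by blast+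
  then show ?thesis by simp
qed

lemma laplacian_row_sum:
  assumes "simple_graph n E" "i < n"
  shows "(\<Sum>j<n. laplacian n E $$ (i, j)) = 0"
  using laplacian_apply[OF assms, of "\<lambda>_. 1"] by simp

text \<open>\<open>g\<close> is the Green's function of the graph: it inverts the Laplacian on
  vectors of sum zero and annihilates constants. The conditions are first expressed through these
  identities alone; the spectral sum provides \<open>g\<close> later.\<close>

locale laplacian_pseudoinverse =
  fixes n :: nat and E :: "nat set set" and g :: "nat \<Rightarrow> nat \<Rightarrow> real"
  assumes simple: "simple_graph n E"
    and conn: "connected_graph n E"
    and g_sym: "i < n \<Longrightarrow> j < n \<Longrightarrow> g i j = g j i"
    and g_row_sum: "i < n \<Longrightarrow> (\<Sum>j<n. g i j) = 0"
    and laplacian_g: "i < n \<Longrightarrow> j < n \<Longrightarrow>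
      (\<Sum>k<n. laplacian n E $$ (i, k) * g k j) = (if i = j then 1 else 0) - 1 / real n"
begin

lemma n_pos: "0 < n"
  using conn by (simp add: connected_graph_def)

text \<open>Both products of the Laplacian with \<open>g\<close> are the orthogonal projection
  \<open>?P\<close> onto vectors of sum zero. It is symmetric and fixes both matrices, because their
  columns sum to zero.\<close>

lemma mp_inverse_laplacian: "mp_inverse (laplacian n E) = mat n n (\<lambda>(i, j). g i j)"
proof (rule mp_inverse_eqI)
  let ?L = "laplacian n E" and ?G = "mat n n (\<lambda>(i, j). g i j)"
  let ?P = "mat n n (\<lambda>(i, j). (if i = j then 1 else 0) - 1 / real n)"
  have LG: "?L * ?G = ?P"
    using laplacian_g by (intro eq_matI) (auto simp: scalar_prod_def atLeast0LessThan)
  have GL: "?G * ?L = ?P"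
  proof (intro eq_matI)
    fix i j assume ij: "i < dim_row ?P" "j < dim_col ?P"
    have "(\<Sum>k<n. g i k * ?L $$ (k, j)) = (\<Sum>k<n. ?L $$ (j, k) * g k i)"
      using ij g_sym laplacian_sym by (intro sum.cong) auto
    then show "(?G * ?L) $$ (i, j) = ?P $$ (i, j)"
      using ij laplacian_g[of j i] by (simp add: scalar_prod_def atLeast0LessThan eq_commute)
  qed auto
  \<comment> \<open>Applying \<open>?P\<close> subtracts the mean of a vector from its
    entries.\<close>
  have P: "(\<Sum>k<n. ((if i = k then 1 else 0) - 1 / real n) * f k) = f i - (\<Sum>k<n. f k) / real n"
    if "i < n" for i and f :: "nat \<Rightarrow> real"
  proof -
    have "(\<Sum>k<n. ((if i = k then 1 else 0) - 1 / real n) * f k) =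
        (\<Sum>k<n. (if i = k then f k else 0) - f k / real n)"
      by (intro sum.cong) (auto simp: left_diff_distrib)
    then show ?thesis
      using that by (simp add: sum_subtractf sum_divide_distrib)
  qed
  have "?P * ?L = ?L"
  proof (intro eq_matI)
    fix i j assume ij: "i < dim_row ?L" "j < dim_col ?L"
    have "(\<Sum>k<n. ?L $$ (k, j)) = (\<Sum>k<n. ?L $$ (j, k))"
      using ij laplacian_sym by (intro sum.cong) auto
    then show "(?P * ?L) $$ (i, j) = ?L $$ (i, j)"
      using ij P[of i "\<lambda>k. ?L $$ (k, j)"] laplacian_row_sum[OF simple, of j]
      by (simp add: scalar_prod_def atLeast0LessThan)
  qed auto
  moreover have "?P * ?G = ?G"
  proof (intro eq_matI)
    fix i j assume ij: "i < dim_row ?G" "j < dim_col ?G"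
    have "(\<Sum>k<n. g k j) = (\<Sum>k<n. g j k)"
      using ij g_sym by (intro sum.cong) auto
    then show "(?P * ?G) $$ (i, j) = ?G $$ (i, j)"
      using ij P[of i "\<lambda>k. g k j"] g_row_sum[of j]
      by (simp add: scalar_prod_def atLeast0LessThan)
  qed auto
  moreover have "transpose_mat ?P = ?P"
    by (intro eq_matI) auto
  ultimately show "is_mp_inverse ?L ?G"
    by (simp add: is_mp_inverse_def LG GL)
qed

text \<open>Column \<open>i\<close> minus column \<open>j\<close> of \<open>g\<close> is a potential
  for the unit flow, since the terms \<open>1 / n\<close> cancel. Any other potential differs from
  it by a kernel vector of the Laplacian, hence by a constant.\<close>

lemma resistance_eq:
  assumes i: "i < n" and j: "j < n"
  shows "resistance n E i j = g i i + g j j - 2 * g i j"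
  unfolding resistance_def
proof (rule the_equality)
  let ?q = "\<lambda>k. g k i - g k j"
  have q: "(\<Sum>l<n. laplacian n E $$ (k, l) * ?q l) =
      (if k = i then 1 else 0) - (if k = j then 1 else 0)" if "k < n" for k
    using laplacian_g[OF that i] laplacian_g[OF that j]
    by (simp add: right_diff_distrib sum_subtractf)
  show "\<exists>p. unit_flow_potential n E i j p \<and> g i i + g j j - 2 * g i j = p i - p j"
  proof (intro exI conjI)
    show "unit_flow_potential n E i j ?q"
      using q laplacian_apply[OF simple, of _ ?q] by (simp add: unit_flow_potential_def)
    show "g i i + g j j - 2 * g i j = ?q i - ?q j"
      using g_sym[OF i j] by simp
  qed
  fix r assume "\<exists>p. unit_flow_potential n E i j p \<and> r = p i - p j"
  then obtain p where p: "unit_flow_potential n E i j p" "r = p i - p j" by blast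
  have "(\<Sum>l<n. laplacian n E $$ (k, l) * (p l - ?q l)) = 0" if "k < n" for k
  proof -
    have "(\<Sum>l<n. laplacian n E $$ (k, l) * p l) =
      (if k = i then 1 else 0) - (if k = j then 1 else 0)"
      using p(1) that laplacian_apply[OF simple that, of p] by (simp add: unit_flow_potential_def)
    then show ?thesis
      using q[OF that] by (subst right_diff_distrib, subst sum_subtractf) simp
  qed
  then have "p i - ?q i = p j - ?q j"
    by (rule laplacian_kernel[OF simple conn _ i j])
  then show "r = g i i + g j j - 2 * g i j"
    using p(2) g_sym[OF i j] by simp
qed

section \<open>The conditions in terms of the diagonal of \<open>g\<close>\<close>

lemma resistance_row_sum:
  assumes "i < n"
  shows "(\<Sum>j<n. resistance n E i j) = real n * g i i + (\<Sum>j<n. g j j)"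
proof -
  have "(\<Sum>j<n. resistance n E i j) = (\<Sum>j<n. g i i + g j j - 2 * g i j)"
    using assms by (intro sum.cong) (auto simp: resistance_eq)
  then show ?thesis
    using g_row_sum[OF assms] by (simp add: sum.distrib sum_subtractf sum_distrib_left[symmetric])
qed

lemma kirchhoff_index_eq: "kirchhoff_index n E = real n * (\<Sum>j<n. g j j)"
  by (simp add: kirchhoff_index_def resistance_row_sum sum.distrib sum_distrib_left[symmetric])

text \<open>A constant diagonal entry is the trace divided by \<open>n\<close>, and the trace is the
  Kirchhoff index divided by \<open>n\<close>.\<close>

lemma constant_diagonal_iff:
  "(\<exists>a. \<forall>i<n. g i i = a) \<longleftrightarrow> (\<forall>i<n. g i i = kirchhoff_index n E / (real n)\<^sup>2)"
proof
  assume "\<exists>a. \<forall>i<n. g i i = a"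
  then obtain a where a: "\<And>i. i < n \<Longrightarrow> g i i = a" by blast
  then have "kirchhoff_index n E = (real n)\<^sup>2 * a"
    by (simp add: kirchhoff_index_eq power2_eq_square)
  then show "\<forall>i<n. g i i = kirchhoff_index n E / (real n)\<^sup>2"
    using a n_pos by simp
qed blast

lemma resistance_regular_iff:
  "resistance_regular n E \<longleftrightarrow> (\<forall>i<n. g i i = kirchhoff_index n E / (real n)\<^sup>2)"
proof -
  have "(\<Sum>j<n. resistance_mat n E $$ (i, j)) = real n * g i i + (\<Sum>j<n. g j j)" if "i < n" for i
    using resistance_row_sum[OF that] that by (simp add: resistance_mat_def)
  then have "resistance_regular n E \<longleftrightarrow>
      (\<exists>c. \<forall>i<n. real n * g i i + (\<Sum>j<n. g j j) = c)"
    by (simp add: resistance_regular_def)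
  also have "\<dots> \<longleftrightarrow> (\<exists>a. \<forall>i<n. g i i = a)"
  proof
    assume "\<exists>c. \<forall>i<n. real n * g i i + (\<Sum>j<n. g j j) = c"
    then obtain c where "\<And>i. i < n \<Longrightarrow> real n * g i i + (\<Sum>j<n. g j j) = c" by blast
    then have "\<forall>i<n. g i i = (c - (\<Sum>j<n. g j j)) / real n"
      using n_pos by (auto simp: field_simps)
    then show "\<exists>a. \<forall>i<n. g i i = a" by blast
  qed auto
  finally show ?thesis
    by (simp add: constant_diagonal_iff)
qed

lemma bottleneck_mat_eq:
  assumes v: "v < n"
  shows "bottleneck_mat n E v \<in> carrier_mat (n - 1) (n - 1)"
    and "mat_delete (laplacian n E) v v * bottleneck_mat n E v = 1\<^sub>m (n - 1)"
    and "entry_sum (bottleneck_mat n E v) = (real n)\<^sup>2 * g v v"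
proof -
  \<comment> \<open>This grounds \<open>g\<close> at \<open>v\<close>: row and column
    \<open>v\<close> of \<open>b\<close> vanish, so sums over the remaining vertices may be extended
    to all vertices.\<close>
  define b where "b = (\<lambda>i j. g i j - g i v - g v j + g v v)"
  define B where "B = mat (n - 1) (n - 1) (\<lambda>(i, j). b (insert_index v i) (insert_index v j))"
  let ?Lv = "mat_delete (laplacian n E) v v"
  have Lv: "?Lv \<in> carrier_mat (n - 1) (n - 1)"
    by (intro carrier_matI) (auto simp: mat_delete_def)
  have B: "B \<in> carrier_mat (n - 1) (n - 1)" by (simp add: B_def)
  have ins: "insert_index v i < n" "insert_index v i \<noteq> v" if "i < n - 1" for i
    using that v by (auto simp: insert_index_def)
  have inj: "insert_index v i = insert_index v j \<longleftrightarrow> i = j" for i j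
    by (auto simp: insert_index_def)
  have b0: "b i v = 0" "b v i = 0" if "i < n" for i
    by (simp_all add: b_def)
  have b_sum: "(\<Sum>k<n. laplacian n E $$ (i, k) * b k j) = (if i = j then 1 else 0)"
    if "i < n" "j < n" "i \<noteq> v" for i j
  proof -
    \<comment> \<open>The part of \<open>b k j\<close> that does not depend on \<open>k\<close> is
      killed by the zero row sum. In the difference of the other two sums \<open>1 / n\<close>
      cancels, and the indicator of \<open>i = v\<close> is 0 because
      \<open>i \<noteq> v\<close>.\<close>
    have "(\<Sum>k<n. laplacian n E $$ (i, k) * b k j) =
        (\<Sum>k<n. laplacian n E $$ (i, k) * g k j) - (\<Sum>k<n. laplacian n E $$ (i, k) * g k v)
        + (\<Sum>k<n. laplacian n E $$ (i, k)) * (g v v - g v j)"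
      unfolding sum_distrib_right sum_subtractf[symmetric] sum.distrib[symmetric]
      by (intro sum.cong) (auto simp: b_def algebra_simps)
    then show ?thesis
      using that laplacian_g[OF that(1,2)] laplacian_g[OF that(1) v]
        laplacian_row_sum[OF simple that(1)] by simp
  qed
  have drop_v: "(\<Sum>k\<in>{..<n} - {v}. f k) = (\<Sum>k<n. f k)" if "f v = 0" for f :: "nat \<Rightarrow> real"
    using that v by (simp add: sum_diff1)
  have LvB: "?Lv * B = 1\<^sub>m (n - 1)"
  proof (intro eq_matI)
    fix i j assume "i < dim_row (1\<^sub>m (n - 1) :: real mat)" "j < dim_col (1\<^sub>m (n - 1) :: real mat)"
    then have ij: "i < n - 1" "j < n - 1" by auto
    let ?i = "insert_index v i" and ?j = "insert_index v j"
    have "(?Lv * B) $$ (i, j) = (\<Sum>k<n - 1. ?Lv $$ (i, k) * B $$ (k, j))"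
      using Lv B ij by (simp add: scalar_prod_def atLeast0LessThan)
    also have "\<dots> = (\<Sum>k<n - 1. (\<lambda>m. laplacian n E $$ (?i, m) * b m ?j) (insert_index v k))"
      using ij by (intro sum.cong) (auto simp: B_def mat_delete_index_insert[of _ n])
    also have "\<dots> = (\<Sum>k<n. laplacian n E $$ (?i, k) * b k ?j)"
      using b0 ins[OF ij(2)] by (subst sum_insert_index[OF v], subst drop_v) auto
    also have "\<dots> = 1\<^sub>m (n - 1) $$ (i, j)"
      using b_sum[of ?i ?j] ins ij inj by simp
    finally show "(?Lv * B) $$ (i, j) = 1\<^sub>m (n - 1) $$ (i, j)" .
  qed (use Lv B in auto)
  have bottleneck: "bottleneck_mat n E v = B"
    by (simp add: bottleneck_mat_def mat_inverse_eqI[OF Lv B LvB])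
  show "bottleneck_mat n E v \<in> carrier_mat (n - 1) (n - 1)"
    and "?Lv * bottleneck_mat n E v = 1\<^sub>m (n - 1)"
    using B LvB bottleneck by simp_all
  have row: "(\<Sum>j<n - 1. b k (insert_index v j)) = (\<Sum>j<n. b k j)" if "k < n" for k
    using sum_insert_index[OF v, of "b k"] drop_v[of "b k"] b0(1)[OF that] by simp
  have "entry_sum B = (\<Sum>i<n - 1. \<Sum>j<n. b (insert_index v i) j)"
    using row ins by (simp add: entry_sum_def B_def)
  also have "\<dots> = (\<Sum>i<n. \<Sum>j<n. b i j)"
    using sum_insert_index[OF v, of "\<lambda>i. \<Sum>j<n. b i j"] drop_v[of "\<lambda>i. \<Sum>j<n. b i j"] b0
    by simp
  also have "\<dots> = (\<Sum>i<n. real n * g v v - real n * g i v)"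
    using v g_row_sum by (intro sum.cong) (auto simp: b_def sum.distrib sum_subtractf)
  also have "\<dots> = (real n)\<^sup>2 * g v v - real n * (\<Sum>i<n. g v i)"
    using v g_sym by (simp add: sum_subtractf sum_distrib_left[symmetric] power2_eq_square)
  finally show "entry_sum (bottleneck_mat n E v) = (real n)\<^sup>2 * g v v"
    using v g_row_sum by (simp add: bottleneck)
qed

text \<open>Deleting row and column \<open>v\<close> keeps the summand \<open>1 / n\<close>, so
  \<open>det_add_const\<close> applies with the bottleneck matrix as the inverse; its entry sum
  divided by \<open>n\<close> is \<open>n * g v v\<close>.\<close>

lemma principal_minor_eq:
  assumes v: "v < n"
  shows "det (mat_delete (laplacian n E + (1 / real n) \<cdot>\<^sub>m ones_mat n) v v) =
    real (num_spanning_trees n E) * (1 + real n * g v v)"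
proof -
  have "mat_delete (laplacian n E + (1 / real n) \<cdot>\<^sub>m ones_mat n) v v =
      mat_delete (laplacian n E) v v + (1 / real n) \<cdot>\<^sub>m ones_mat (n - 1)"
    by (intro eq_matI) (auto simp: mat_delete_def ones_mat_def)
  moreover have "mat_delete (laplacian n E) v v \<in> carrier_mat (n - 1) (n - 1)"
    by (intro carrier_matI) (auto simp: mat_delete_def)
  ultimately show ?thesis
    using det_add_const[of "mat_delete (laplacian n E) v v" "n - 1" "bottleneck_mat n E v" "1 / real n"]
      bottleneck_mat_eq[OF v] matrix_tree[OF simple v] n_pos
    by (simp add: power2_eq_square)
qed

text \<open>Allows \<open>t\<close> to be cancelled in the condition on principal minors.\<close>

lemma num_spanning_trees_pos: "0 < num_spanning_trees n E"
proof -
  obtain T where "T \<subseteq> E" "spans n T {0}" "card T + card {0 :: nat} = n"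
    using spanning_forest_exists[OF simple, of "{0}"] conn n_pos connected_graph_iff_spans by auto
  moreover have "finite {F. F \<subseteq> E \<and> spans n F {0} \<and> card F + card {0 :: nat} = n}"
    using simple_graph_finite[OF simple] by simp
  ultimately show ?thesis
    unfolding num_spanning_trees_eq[OF simple n_pos] by (subst card_gt_0_iff) blast
qed

text \<open>This is the diagonal case of \<open>laplacian_g\<close>, with the Laplacian read as a
  sum of differences over the neighbours of \<open>i\<close>.\<close>

lemma nbrs_sum_eq:
  assumes "i < n"
  shows "(\<Sum>j\<in>nbrs E i. g i j) = real (card (nbrs E i)) * g i i + 1 / real n - 1"
proof -
  have "(\<Sum>j\<in>nbrs E i. g i j) = (\<Sum>j\<in>nbrs E i. g j i)"
    using assms g_sym nbrs_subset[OF simple, of i] by (intro sum.cong) auto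
  then show ?thesis
    using laplacian_g[OF assms assms] laplacian_apply[OF simple assms, of "\<lambda>k. g k i"]
    by (simp add: sum_subtractf)
qed

text \<open>Allows the degree to be cancelled in the condition on neighbour sums.\<close>

lemma nbrs_nonempty:
  assumes "i < n" "n \<noteq> 1"
  shows "card (nbrs E i) \<noteq> 0"
proof -
  obtain j where "j < n" "j \<noteq> i"
    using assms by (metis less_one linorder_neqE_nat n_pos not_less_iff_gr_or_eq)
  then have "(i, j) \<in> (edge_rel E)\<^sup>*"
    using conn assms by (simp add: connected_graph_def)
  then obtain k where "{i, k} \<in> E"
    using \<open>j \<noteq> i\<close> by (auto elim: converse_rtranclE)
  then show ?thesis
    using finite_nbrs[OF simple, of i] by (auto simp: nbrs_def)
qed

end

text \<open>The Laplacian cancels the factors \<open>1 / lam k\<close>, which leaves the resolution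
  of the identity without the kernel vectors. By connectedness these are constant, so the missing
  part is a constant matrix.\<close>

lemma laplacian_pseudoinverse_spectral:
  fixes lam :: "nat \<Rightarrow> real" and c :: "nat \<Rightarrow> real vec"
  assumes simple: "simple_graph n E" and conn: "connected_graph n E"
    and eigen: "\<And>k. k < n \<Longrightarrow> eigenvector (laplacian n E) (c k) (lam k)"
    and orthonormal: "\<And>k l. k < n \<Longrightarrow> l < n \<Longrightarrow> c k \<bullet> c l = (if k = l then 1 else 0)"
  shows "laplacian_pseudoinverse n E
    (\<lambda>i j. \<Sum>k | k < n \<and> lam k \<noteq> 0. c k $ i * c k $ j / lam k)"
proof -
  let ?L = "laplacian n E"
  define K Z where "K = {k. k < n \<and> lam k \<noteq> 0}" and "Z = {k. k < n \<and> lam k = 0}"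
  define g where "g = (\<lambda>i j. \<Sum>k\<in>K. c k $ i * c k $ j / lam k)"
  have n: "0 < n" using conn by (simp add: connected_graph_def)
  have KZ: "{..<n} = K \<union> Z" "K \<inter> Z = {}" "finite K" "finite Z"
    by (auto simp: K_def Z_def)
  have dim: "c k \<in> carrier_vec n" if "k < n" for k
    using eigen[OF that] by (simp add: eigenvector_def)
  have eig: "(\<Sum>m<n. ?L $$ (i, m) * c k $ m) = lam k * c k $ i" if "k < n" "i < n" for k i
  proof -
    have "(?L *\<^sub>v c k) $ i = (lam k \<cdot>\<^sub>v c k) $ i"
      using eigen[OF that(1)] by (simp add: eigenvector_def)
    then show ?thesis
      using dim[OF that(1)] that(2) by (simp add: scalar_prod_def atLeast0LessThan)
  qed
  \<comment> \<open>Orthonormality says that the rows of a square matrix \<open>?C\<close> are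
    orthonormal; then so are its columns.\<close>
  have complete: "(\<Sum>k<n. c k $ i * c k $ j) = (if i = j then 1 else 0)"
    if "i < n" "j < n" for i j
  proof -
    let ?C = "mat n n (\<lambda>(k, i). c k $ i)"
    have "(\<Sum>m<n. c k $ m * c l $ m) = (if k = l then 1 else 0)" if "k < n" "l < n" for k l
      using orthonormal[OF that] dim[OF that(2)] by (simp add: scalar_prod_def atLeast0LessThan)
    then have "?C * transpose_mat ?C = 1\<^sub>m n"
      by (intro eq_matI) (auto simp: scalar_prod_def atLeast0LessThan)
    then have "transpose_mat ?C * ?C = 1\<^sub>m n"
      by (intro mat_mult_left_right_inverse[of ?C n]) auto
    then have "(transpose_mat ?C * ?C) $$ (i, j) = 1\<^sub>m n $$ (i, j)" by simp
    then show ?thesis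
      using that by (simp add: scalar_prod_def atLeast0LessThan)
  qed
  \<comment> \<open>\<open>d k\<close> is the common value of the entries of the constant kernel
    vector \<open>c k\<close>, read off at vertex 0.\<close>
  define d where "d = (\<lambda>k. c k $ 0)"
  have "c k $ i = d k" if "k \<in> Z" "i < n" for k i
    unfolding d_def using that eig[of k] n by (intro laplacian_kernel[OF simple conn]) (auto simp: Z_def)
  then have Z_sum: "(\<Sum>k\<in>Z. c k $ i * c k $ j) = (\<Sum>k\<in>Z. d k * d k)"
    if "i < n" "j < n" for i j
    using that by (intro sum.cong) auto
  define \<beta> where "\<beta> = (\<Sum>k\<in>Z. d k * d k)"
  have Lg: "(\<Sum>m<n. ?L $$ (i, m) * g m j) = (if i = j then 1 else 0) - \<beta>"
    if "i < n" "j < n" for i j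
  proof -
    have "(\<Sum>m<n. ?L $$ (i, m) * g m j) =
        (\<Sum>k\<in>K. (\<Sum>m<n. ?L $$ (i, m) * c k $ m) * c k $ j / lam k)"
      unfolding g_def sum_distrib_left sum_distrib_right sum_divide_distrib
      by (subst sum.swap) (simp add: mult_ac)
    also have "\<dots> = (\<Sum>k\<in>K. c k $ i * c k $ j)"
      using that eig by (intro sum.cong) (auto simp: K_def)
    also have "\<dots> = (\<Sum>k<n. c k $ i * c k $ j) - (\<Sum>k\<in>Z. c k $ i * c k $ j)"
      unfolding KZ(1) sum.union_disjoint[OF KZ(3,4,2)] by simp
    finally show ?thesis
      using that by (simp add: complete Z_sum \<beta>_def)
  qed
  have col: "(\<Sum>i<n. ?L $$ (i, m)) = 0" if "m < n" for m
  proof -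
    have "(\<Sum>i<n. ?L $$ (i, m)) = (\<Sum>i<n. ?L $$ (m, i))"
      using that laplacian_sym by (intro sum.cong) auto
    then show ?thesis using laplacian_row_sum[OF simple that] by simp
  qed
  have col_apply: "(\<Sum>i<n. \<Sum>m<n. ?L $$ (i, m) * p m) = 0" for p
    using col by (subst sum.swap) (simp add: sum_distrib_right[symmetric])
  \<comment> \<open>The columns of the Laplacian sum to zero, so column 0 of its product with
    \<open>g\<close> does too; this gives \<open>1 - n * \<beta> = 0\<close>.\<close>
  have "0 = (\<Sum>i<n. (if i = 0 then 1 else 0) - \<beta>)"
    using col_apply[of "\<lambda>m. g m 0"] Lg n by simp
  then have \<beta>: "\<beta> = 1 / real n"
    using n by (simp add: sum_subtractf field_simps)
  have "(\<Sum>i<n. c k $ i) = 0" if "k \<in> K" for k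
  proof -
    \<comment> \<open>The entries of the Laplacian applied to \<open>c k\<close> add up to zero, and
      \<open>lam k\<close> is nonzero on \<open>K\<close>.\<close>
    have "lam k * (\<Sum>i<n. c k $ i) = 0"
      using col_apply[of "\<lambda>m. c k $ m"] eig that by (simp add: K_def sum_distrib_left)
    then show ?thesis using that by (simp add: K_def)
  qed
  then have row: "(\<Sum>j<n. g i j) = 0" for i
    unfolding g_def
    by (subst sum.swap) (simp add: sum_divide_distrib[symmetric] sum_distrib_left[symmetric])
  have "laplacian_pseudoinverse n E g"
    using simple conn row Lg \<beta> by unfold_locales (auto simp: g_def mult.commute)
  then show ?thesis
    by (simp add: g_def K_def)
qed

section \<open>Each condition as constancy of the diagonal of the pseudoinverse\<close>

theorem theorem2p30:
  fixes n t :: nat and E :: "nat set set"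
    and L Lp R :: "real mat" and Kf :: real
    and lam :: "nat \<Rightarrow> real" and c :: "nat \<Rightarrow> real vec"
  assumes graph: "simple_graph n E"
    and conn: "connected_graph n E"
    and L_def: "L = laplacian n E"
    and Lp_def: "Lp = mp_inverse L"
    and R_def: "R = resistance_mat n E"
    and Kf_def: "Kf = kirchhoff_index n E"
    and t_def: "t = num_spanning_trees n E"
    and eigen: "\<And>k. k < n \<Longrightarrow> eigenvector L (c k) (lam k)"
    and orthonormal: "\<And>k l. k < n \<Longrightarrow> l < n \<Longrightarrow> c k \<bullet> c l = (if k = l then 1 else 0)"
  shows
    "(resistance_regular n E \<longleftrightarrow> (\<forall>i<n. Lp $$ (i, i) = Kf / (real n)\<^sup>2)) \<and>
     (resistance_regular n E \<longleftrightarrow> (\<exists>a. \<forall>i<n. \<forall>j<n. R $$ (i, j) + 2 * Lp $$ (i, j) = a)) \<and>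
     (resistance_regular n E \<longleftrightarrow> R = 2 \<cdot>\<^sub>m (Lp $$ (0, 0) \<cdot>\<^sub>m ones_mat n - Lp)) \<and>
     (resistance_regular n E \<longleftrightarrow> (\<exists>a. \<forall>i<n. entry_sum (bottleneck_mat n E i) = a)) \<and>
     (resistance_regular n E \<longleftrightarrow>
        (\<exists>a. \<forall>i<n. (\<Sum>k | k < n \<and> lam k \<noteq> 0. (c k $ i)\<^sup>2 / lam k) = a)) \<and>
     (resistance_regular n E \<longleftrightarrow>
        (\<forall>i<n. det (mat_delete (L + (1 / real n) \<cdot>\<^sub>m ones_mat n) i i) = real t * (1 + Kf / real n))) \<and>
     (resistance_regular n E \<longleftrightarrow>
        (\<forall>i<n. (\<Sum>j\<in>nbrs E i. Lp $$ (i, j)) =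
                 real (card (nbrs E i)) * Kf / (real n)\<^sup>2 + 1 / real n - 1))"
proof -
  define g where "g = (\<lambda>i j. \<Sum>k | k < n \<and> lam k \<noteq> 0. c k $ i * c k $ j / lam k)"
  interpret laplacian_pseudoinverse n E g
    unfolding g_def
    by (rule laplacian_pseudoinverse_spectral[OF graph conn eigen[unfolded L_def] orthonormal])
  have Lp: "Lp = mat n n (\<lambda>(i, j). g i j)"
    by (simp add: Lp_def L_def mp_inverse_laplacian)
  have R: "R $$ (i, j) = g i i + g j j - 2 * g i j" if "i < n" "j < n" for i j
    using that by (simp add: R_def resistance_mat_def resistance_eq)
  have regular: "resistance_regular n E \<longleftrightarrow> (\<forall>i<n. g i i = Kf / (real n)\<^sup>2)"
    by (simp add: Kf_def resistance_regular_iff)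
  then have const_diag: "resistance_regular n E \<longleftrightarrow> (\<exists>a. \<forall>i<n. g i i = a)"
    by (simp add: Kf_def constant_diagonal_iff)
  have ii: "resistance_regular n E \<longleftrightarrow> (\<forall>i<n. Lp $$ (i, i) = Kf / (real n)\<^sup>2)"
    by (simp add: regular Lp)
  have iii: "resistance_regular n E \<longleftrightarrow> (\<exists>a. \<forall>i<n. \<forall>j<n. R $$ (i, j) + 2 * Lp $$ (i, j) = a)"
  proof -
    \<comment> \<open>The mixed terms cancel in \<open>R $$ (i, j) + 2 * Lp $$ (i, j)\<close>; the
      case \<open>i = j\<close> then isolates the diagonal.\<close>
    have "(\<exists>a. \<forall>i<n. \<forall>j<n. g i i + g j j = a) \<longleftrightarrow> (\<exists>a. \<forall>i<n. g i i = a)"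
    proof
      assume "\<exists>a. \<forall>i<n. \<forall>j<n. g i i + g j j = a"
      then obtain a where a: "\<And>i. i < n \<Longrightarrow> g i i + g i i = a" by blast
      have "g i i = a / 2" if "i < n" for i
        using a[OF that] by simp
      then show "\<exists>a. \<forall>i<n. g i i = a" by blast
    qed auto
    then show ?thesis by (simp add: const_diag R Lp)
  qed
  have iv: "resistance_regular n E \<longleftrightarrow> R = 2 \<cdot>\<^sub>m (Lp $$ (0, 0) \<cdot>\<^sub>m ones_mat n - Lp)"
  proof -
    have "R = 2 \<cdot>\<^sub>m (Lp $$ (0, 0) \<cdot>\<^sub>m ones_mat n - Lp) \<longleftrightarrow>
        (\<forall>i<n. \<forall>j<n. R $$ (i, j) = 2 * (g 0 0 - g i j))"
      using n_pos by (auto simp: mat_eq_iff R_def resistance_mat_def Lp ones_mat_def)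
    also have "\<dots> \<longleftrightarrow> (\<forall>i<n. \<forall>j<n. g i i + g j j = 2 * g 0 0)"
      by (auto simp: R algebra_simps)
    also have "\<dots> \<longleftrightarrow> (\<exists>a. \<forall>i<n. g i i = a)"
    proof
      assume "\<forall>i<n. \<forall>j<n. g i i + g j j = 2 * g 0 0"
      then have "\<forall>i<n. g i i = g 0 0" by fastforce
      then show "\<exists>a. \<forall>i<n. g i i = a" by blast
    qed (use n_pos in auto)
    finally show ?thesis by (simp add: const_diag)
  qed
  have v: "resistance_regular n E \<longleftrightarrow> (\<exists>a. \<forall>i<n. entry_sum (bottleneck_mat n E i) = a)"
  proof -
    have "(\<exists>a. \<forall>i<n. (real n)\<^sup>2 * g i i = a) \<longleftrightarrow> (\<exists>a. \<forall>i<n. g i i = a)"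
    proof
      assume "\<exists>a. \<forall>i<n. (real n)\<^sup>2 * g i i = a"
      then obtain a where "\<And>i. i < n \<Longrightarrow> (real n)\<^sup>2 * g i i = a" by blast
      then have "\<forall>i<n. g i i = a / (real n)\<^sup>2"
        using n_pos by (auto simp: field_simps)
      then show "\<exists>a. \<forall>i<n. g i i = a" by blast
    qed auto
    then show ?thesis by (simp add: const_diag bottleneck_mat_eq(3))
  qed
  have vi: "resistance_regular n E \<longleftrightarrow>
      (\<exists>a. \<forall>i<n. (\<Sum>k | k < n \<and> lam k \<noteq> 0. (c k $ i)\<^sup>2 / lam k) = a)"
    by (simp add: const_diag g_def power2_eq_square)
  have vii: "resistance_regular n E \<longleftrightarrow>
      (\<forall>i<n. det (mat_delete (L + (1 / real n) \<cdot>\<^sub>m ones_mat n) i i) = real t * (1 + Kf / real n))"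
  proof -
    have "real t * (1 + real n * g i i) = real t * (1 + Kf / real n) \<longleftrightarrow> g i i = Kf / (real n)\<^sup>2" for i
      using num_spanning_trees_pos n_pos by (simp add: t_def field_simps power2_eq_square)
    then show ?thesis
      using principal_minor_eq by (simp add: regular L_def t_def)
  qed
  have viii: "resistance_regular n E \<longleftrightarrow>
      (\<forall>i<n. (\<Sum>j\<in>nbrs E i. Lp $$ (i, j)) =
                 real (card (nbrs E i)) * Kf / (real n)\<^sup>2 + 1 / real n - 1)"
  proof -
    have sum: "(\<Sum>j\<in>nbrs E i. Lp $$ (i, j)) = real (card (nbrs E i)) * g i i + 1 / real n - 1"
      if "i < n" for i
    proof -
      have "(\<Sum>j\<in>nbrs E i. Lp $$ (i, j)) = (\<Sum>j\<in>nbrs E i. g i j)"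
        using that nbrs_subset[OF graph, of i] by (intro sum.cong) (auto simp: Lp)
      then show ?thesis using nbrs_sum_eq[OF that] by simp
    qed
    show ?thesis
    proof (cases "n = 1")
      case True
      \<comment> \<open>For a single vertex the degree is 0 and cannot be cancelled. Both sides hold
        outright: the neighbour condition reads \<open>0 = 0 + 1 - 1\<close>.\<close>
      have "nbrs E 0 = {}"
        using nbrs_subset[OF graph, of 0] simple_graph_edge(3)[OF graph] True
        by (fastforce simp: nbrs_def)
      moreover have "resistance_regular n E"
        unfolding const_diag using True by auto
      ultimately show ?thesis
        using True by simp
    next
      case False
      then have "real (card (nbrs E i)) * g i i = real (card (nbrs E i)) * Kf / (real n)\<^sup>2 \<longleftrightarrow>
          g i i = Kf / (real n)\<^sup>2" if "i < n" for i
        using nbrs_nonempty[OF that False] by (simp flip: times_divide_eq_right)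
      then show ?thesis
        by (simp add: regular sum)
    qed
  qed
  show ?thesis
    using ii iii iv v vi vii viii by blast
qed

end
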